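(* Let $q$ be a complex number with $|q|<1$. Then \[ \sum_{k=0}^{\infty}\frac{(q;q)_k}{(q;q^2)_{k+1}}\,q^{\binom{k+1}{2}} =\frac{(q^2;q^2)_{\infty}^2}{(q;q^2)_{\infty}^2}. \]
   Context: For complex $x,p$ with $|p|<1$ and integer $n\ge 0$: $(x;p)_\infty=\prod_{i=0}^{\infty}(1-xp^i)$ and $(x;p)_n=\prod_{i=0}^{n-1}(1-xp^i)$ (so $(x;p)_0=1$). *)

theory Defs
  imports "HOL-Analysis.Analysis"
begin

definition qpoch :: "complex \<Rightarrow> complex \<Rightarrow> nat \<Rightarrow> complex" where
  "qpoch x p n = (\<Prod>i<n. 1 - x * p ^ i)"

text \<open>Meant for \<open>norm p < 1\<close>, where the product always converges in the library's sense
  (a vanishing factor is allowed and gives the value 0).\<close>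

definition qpoch_inf :: "complex \<Rightarrow> complex \<Rightarrow> complex" where
  "qpoch_inf x p = (\<Prod>i. 1 - x * p ^ i)"

end

theory Submission
  imports Defs
begin

text \<open>The identity is the case \<open>a = b = q\<close> of Andrews' \<open>q\<close>-analogue of Gauss's second summation
  theorem: with
  \<open>F a = (\<Sum>n. (a;q)\<^sub>n (b;q)\<^sub>n q^(n(n+1)/2) / ((q;q)\<^sub>n (abq;q\<^sup>2)\<^sub>n))\<close>
  one has \<open>F a = (aq;q\<^sup>2)\<^sub>\<infinity> (bq;q\<^sup>2)\<^sub>\<infinity> / ((abq;q\<^sup>2)\<^sub>\<infinity> (q;q\<^sup>2)\<^sub>\<infinity>)\<close>.
  A telescoping certificate gives \<open>(1 - abq) F a = (1 - aq) F (aq\<^sup>2)\<close>, and iterating it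
  \<open>(abq;q\<^sup>2)\<^sub>\<infinity> F a = (aq;q\<^sup>2)\<^sub>\<infinity> F 0\<close>. The unknown \<open>F 0\<close> is determined by taking \<open>a = 1\<close>, where
  the series reduces to its first term and so \<open>F 1 = 1\<close>.\<close>

section \<open>Finite and infinite q-shifted factorials: recursions, bounds, convergence\<close>

lemma qpoch_0 [simp]: "qpoch x p 0 = 1"
  by (simp add: qpoch_def)

lemma qpoch_Suc: "qpoch x p (Suc n) = qpoch x p n * (1 - x * p ^ n)"
  by (simp add: qpoch_def)

lemma qpoch_Suc_left: "qpoch x p (Suc n) = (1 - x) * qpoch (x * p) p n"
  unfolding qpoch_def by (subst prod.lessThan_Suc_shift) (simp add: mult.assoc)

text \<open>The leading factor is \<open>1 - 1\<close>. As a simp rule this later cuts the series at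
  \<open>a = 1\<close> down to its first term.\<close>

lemma qpoch_1_Suc [simp]: "qpoch 1 p (Suc n) = 0"
  by (simp add: qpoch_Suc_left)

lemma norm_mult_power_le:
  fixes x p :: complex
  assumes "norm p \<le> 1"
  shows "norm (x * p ^ i) \<le> norm x"
  using assms by (simp add: norm_mult norm_power mult_left_le power_le_one)

lemma qpoch_factor_nonzero:
  fixes x p :: complex
  assumes "norm x < 1" "norm p \<le> 1"
  shows "1 - x * p ^ i \<noteq> 0"
proof
  assume "1 - x * p ^ i = 0"
  then have "norm (x * p ^ i) = 1" by simp
  with norm_mult_power_le[OF assms(2), of x i] assms(1) show False by simp
qed

lemma qpoch_nonzero:
  assumes "norm x < 1" "norm p \<le> 1"
  shows "qpoch x p n \<noteq> 0"
  using qpoch_factor_nonzero[OF assms] by (simp add: qpoch_def)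

lemma norm_qpoch_le:
  assumes "norm x \<le> 1" "norm p \<le> 1"
  shows "norm (qpoch x p n) \<le> 2 ^ n"
proof -
  have "norm (1 - x * p ^ i) \<le> 2" for i
    using norm_triangle_ineq4[of 1 "x * p ^ i"] norm_mult_power_le[OF assms(2), of x i] assms(1)
    by simp
  then have "(\<Prod>i<n. norm (1 - x * p ^ i)) \<le> (\<Prod>i<n. 2)"
    by (intro prod_mono) simp
  then show ?thesis by (simp add: qpoch_def prod_norm)
qed

text \<open>The bound \<open>r\<close> is kept apart from \<open>norm x\<close> so that the two
  shifted factorials in a denominator, with different \<open>x\<close>, can share the base
  \<open>1 - norm q\<close>.\<close>

lemma norm_qpoch_ge:
  assumes "norm x \<le> r" "r \<le> 1" "norm p \<le> 1"
  shows "(1 - r) ^ n \<le> norm (qpoch x p n)"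
proof -
  have "1 - r \<le> norm (1 - x * p ^ i)" for i
    using norm_triangle_ineq2[of 1 "x * p ^ i"] norm_mult_power_le[OF assms(3), of x i] assms(1)
    by simp
  then have "(\<Prod>i<n. 1 - r) \<le> (\<Prod>i<n. norm (1 - x * p ^ i))"
    using assms(2) by (intro prod_mono) simp
  then show ?thesis by (simp add: qpoch_def prod_norm)
qed

lemma convergent_prod_qpoch:
  fixes x p :: complex
  assumes "norm p < 1"
  shows "convergent_prod (\<lambda>i. 1 - x * p ^ i)"
proof (intro abs_convergent_prod_imp_convergent_prod summable_imp_abs_convergent_prod)
  show "summable (\<lambda>i. norm (1 - x * p ^ i - 1))"
    using assms by (simp add: norm_mult norm_power summable_mult summable_geometric)
qed

lemma qpoch_tendsto:
  assumes "norm p < 1"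
  shows "(\<lambda>n. qpoch x p n) \<longlonglongrightarrow> qpoch_inf x p"
proof -
  have "(\<lambda>n. qpoch x p (Suc n)) \<longlonglongrightarrow> qpoch_inf x p"
    using convergent_prod_LIMSEQ[OF convergent_prod_qpoch[OF assms, of x]]
    by (simp add: qpoch_def qpoch_inf_def lessThan_Suc_atMost)
  then show ?thesis by (simp only: filterlim_sequentially_Suc)
qed

lemma qpoch_inf_nonzero:
  assumes "norm x < 1" "norm p < 1"
  shows "qpoch_inf x p \<noteq> 0"
  unfolding qpoch_inf_def
  using prodinf_nonzero[OF convergent_prod_qpoch[OF assms(2), of x]] qpoch_factor_nonzero assms
  by simp

lemma qpoch_inf_rec:
  assumes "norm p < 1"
  shows "qpoch_inf x p = (1 - x) * qpoch_inf (x * p) p"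
proof (rule LIMSEQ_unique)
  show "(\<lambda>n. qpoch x p (Suc n)) \<longlonglongrightarrow> qpoch_inf x p"
    using LIMSEQ_Suc[OF qpoch_tendsto[OF assms]] .
  show "(\<lambda>n. qpoch x p (Suc n)) \<longlonglongrightarrow> (1 - x) * qpoch_inf (x * p) p"
    unfolding qpoch_Suc_left by (intro tendsto_mult tendsto_const qpoch_tendsto assms)
qed

section \<open>The terms of Andrews' series and a common majorant\<close>

lemma Suc_Suc_choose_2: "Suc (Suc n) choose 2 = (Suc n choose 2) + Suc n"
  by (simp add: numeral_2_eq_2)

definition gauss_term :: "complex \<Rightarrow> complex \<Rightarrow> complex \<Rightarrow> nat \<Rightarrow> complex" where
  "gauss_term q a b n =
     qpoch a q n * qpoch b q n * q ^ (Suc n choose 2) / (qpoch q q n * qpoch (a * b * q) (q\<^sup>2) n)"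

text \<open>With \<open>r = norm q\<close>, each step of \<open>n\<close> adds two numerator factors
  of norm at most 2 and two denominator factors of norm at least \<open>1 - r\<close>. The bound is
  free of \<open>a\<close> and \<open>b\<close>, so it serves for summability, for the vanishing
  boundary term and for the limit in \<open>a\<close>.\<close>

definition gauss_majorant :: "real \<Rightarrow> nat \<Rightarrow> real" where
  "gauss_majorant r n = (4 / (1 - r)\<^sup>2) ^ n * r ^ (Suc n choose 2)"

text \<open>The quotient of consecutive terms is \<open>C * r ^ Suc n\<close>, which tends to 0: the
  quadratic exponent of \<open>r\<close> beats the geometric growth.\<close>

lemma summable_gauss_majorant:
  assumes "0 \<le> r" "r < 1"
  shows "summable (gauss_majorant r)"
proof -
  define C where "C = 4 / (1 - r)\<^sup>2"
  have "(\<lambda>n. C * r ^ Suc n) \<longlonglongrightarrow> C * 0"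
    by (intro tendsto_mult tendsto_const LIMSEQ_Suc LIMSEQ_power_zero) (use assms in simp)
  then have "eventually (\<lambda>n. C * r ^ Suc n < 1/2) sequentially"
    by (rule order_tendstoD) simp
  then obtain N where N: "\<And>n. n \<ge> N \<Longrightarrow> C * r ^ Suc n < 1/2"
    by (auto simp: eventually_sequentially)
  show ?thesis
  proof (rule summable_ratio_test[of "1/2" N])
    fix n assume "n \<ge> N"
    have nn: "gauss_majorant r n \<ge> 0" for n
      using assms by (simp add: gauss_majorant_def)
    have "gauss_majorant r (Suc n) = (C * r ^ Suc n) * gauss_majorant r n"
      by (simp add: gauss_majorant_def C_def Suc_Suc_choose_2 power_add mult_ac del: power_divide)
    also have "\<dots> \<le> 1/2 * gauss_majorant r n"
      using N[OF \<open>n \<ge> N\<close>] nn by (intro mult_right_mono) auto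
    finally show "norm (gauss_majorant r (Suc n)) \<le> 1/2 * norm (gauss_majorant r n)"
      using nn by simp
  qed simp
qed

section \<open>Fixed \<open>q\<close> in the unit disc: recurrence in \<open>a\<close>, its
  iteration, and the evaluation\<close>

context
  fixes q :: complex
  assumes q: "norm q < 1"
begin

lemma norm_q_square: "norm (q\<^sup>2) < 1"
  using q by (simp add: norm_power power_less_one_iff)

lemma norm_ab_q_le:
  assumes "norm a \<le> 1" "norm b \<le> 1"
  shows "norm (a * b * q) \<le> norm q"
  using assms by (simp add: norm_mult mult_le_one mult_left_le_one_le)

text \<open>The parameter \<open>d\<close> is free because two quotients are needed: the terms of
  the series have \<open>d = a*b*q\<close>, the telescoping boundary term has
  \<open>d = a*b*q^3\<close>.\<close>

lemma norm_gauss_quotient_le: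
  assumes "norm a \<le> 1" "norm b \<le> 1" "norm d \<le> norm q"
  shows "norm (qpoch a q n * qpoch b q n * q ^ (Suc n choose 2) / (qpoch q q n * qpoch d (q\<^sup>2) n))
           \<le> gauss_majorant (norm q) n"
proof -
  have q2: "norm (q\<^sup>2) \<le> 1" using norm_q_square by simp
  have "norm (qpoch a q n * qpoch b q n * q ^ (Suc n choose 2) / (qpoch q q n * qpoch d (q\<^sup>2) n))
      = (norm (qpoch a q n) * norm (qpoch b q n) * norm q ^ (Suc n choose 2))
          / (norm (qpoch q q n) * norm (qpoch d (q\<^sup>2) n))"
    by (simp add: norm_mult norm_divide norm_power)
  also have "\<dots> \<le> (2 ^ n * 2 ^ n * norm q ^ (Suc n choose 2)) / ((1 - norm q) ^ n * (1 - norm q) ^ n)"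
    using q q2 assms
    by (intro frac_le mult_mono norm_qpoch_le norm_qpoch_ge mult_pos_pos mult_nonneg_nonneg) auto
  also have "\<dots> = gauss_majorant (norm q) n"
    by (simp add: gauss_majorant_def power_divide power2_eq_square flip: power_mult_distrib)
  finally show ?thesis .
qed

lemma norm_gauss_term_le:
  assumes "norm a \<le> 1" "norm b \<le> 1"
  shows "norm (gauss_term q a b n) \<le> gauss_majorant (norm q) n"
  unfolding gauss_term_def by (intro norm_gauss_quotient_le assms norm_ab_q_le)

lemma summable_gauss_term:
  assumes "norm a \<le> 1" "norm b \<le> 1"
  shows "summable (gauss_term q a b)"
proof (rule summable_comparison_test')
  show "summable (gauss_majorant (norm q))"
    using q by (intro summable_gauss_majorant) auto
qed (rule norm_gauss_term_le[OF assms])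

text \<open>The right-hand side is the telescoping certificate: its increment from \<open>N\<close>
  to \<open>Suc N\<close> is the summand at \<open>Suc N\<close>. After division by common factors
  this is a polynomial identity in \<open>a\<close>, \<open>b\<close>, \<open>q\<close> and
  \<open>q^N\<close>.\<close>

lemma gauss_term_telescope:
  assumes a: "norm a \<le> 1" and b: "norm b \<le> 1"
  shows "(\<Sum>n\<le>N. (1 - a*b*q) * gauss_term q a b n - (1 - a*q) * gauss_term q (a*q\<^sup>2) b n)
    = a * q ^ Suc N * (1 - b * q^N) *
      (qpoch (a*q) q N * qpoch b q N * q ^ (Suc N choose 2) / (qpoch q q N * qpoch (a*b*q^3) (q\<^sup>2) N))"
proof (induction N)
  case 0
  show ?case by (simp add: gauss_term_def algebra_simps numeral_2_eq_2)
next
  case (Suc n)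
  define x where "x = q ^ n"
  define P where "P = qpoch (a*q) q n"
  define B where "B = qpoch b q n"
  define Q where "Q = qpoch q q n"
  define D where "D = qpoch (a*b*q^3) (q\<^sup>2) n"
  define e where "e = q ^ (Suc n choose 2)"
  have abq: "norm (a*b*q) < 1" using norm_ab_q_le[OF a b] q by simp
  have q2: "norm (q\<^sup>2) \<le> 1" using norm_q_square by simp
  have abq3_eq: "a*b*q^3 = (a*b*q)*q\<^sup>2" by (simp add: power2_eq_square power3_eq_cube)
  have abq3: "norm (a*b*q^3) < 1"
    using norm_mult_power_le[of "q\<^sup>2" "a*b*q" 1] q2 abq by (simp add: abq3_eq)
  have xx: "(q\<^sup>2)^n = x\<^sup>2" by (simp add: x_def flip: power_mult) (simp add: mult.commute)
  have nz: "Q \<noteq> 0" "D \<noteq> 0" "1 - q*x \<noteq> 0" "1 - a*b*q^3*x\<^sup>2 \<noteq> 0" "1 - a*b*q \<noteq> 0"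
    using qpoch_nonzero[of q q] qpoch_nonzero[OF abq3 q2] qpoch_factor_nonzero[of q q n]
      qpoch_factor_nonzero[OF abq3 q2, of n] abq q
    by (auto simp: Q_def D_def x_def[symmetric] xx)
  have Qs: "qpoch q q (Suc n) = Q * (1 - q*x)" by (simp add: qpoch_Suc Q_def x_def)
  have Bs: "qpoch b q (Suc n) = B * (1 - b*x)" by (simp add: qpoch_Suc B_def x_def)
  have Ds: "qpoch (a*b*q) (q\<^sup>2) (Suc n) = (1 - a*b*q) * D"
    by (simp add: qpoch_Suc_left D_def abq3_eq)
  have Ds': "qpoch (a*b*q^3) (q\<^sup>2) (Suc n) = D * (1 - a*b*q^3*x\<^sup>2)"
    by (simp add: qpoch_Suc D_def xx)
  have Ds'': "qpoch (a*q\<^sup>2*b*q) (q\<^sup>2) (Suc n) = D * (1 - a*b*q^3*x\<^sup>2)"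
    using Ds' by (simp add: power2_eq_square power3_eq_cube mult_ac)
  have As: "qpoch a q (Suc n) = (1 - a) * P" by (simp add: qpoch_Suc_left P_def)
  have As': "qpoch (a*q) q (Suc n) = P * (1 - a*q*x)" by (simp add: qpoch_Suc P_def x_def)
  \<comment> \<open>The shifted factorial of \<open>a*q\<^sup>2\<close> starts one factor too late
    to contain \<open>P\<close>; the coefficient \<open>1 - a*q\<close> of the recurrence supplies
    the missing factor.\<close>
  have "(1 - a*q) * qpoch (a*q\<^sup>2) q (Suc n) = qpoch (a*q) q (Suc (Suc n))"
    by (simp add: qpoch_Suc_left[of "a*q"] power2_eq_square mult.assoc)
  also have "\<dots> = P * (1 - a*q*x) * (1 - a*q\<^sup>2*x)"
    by (simp add: qpoch_Suc[of _ _ "Suc n"] As' x_def power2_eq_square mult_ac)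
  finally have As'': "(1 - a*q) * qpoch (a*q\<^sup>2) q (Suc n) = P * (1 - a*q*x) * (1 - a*q\<^sup>2*x)" .
  have es: "q ^ (Suc (Suc n) choose 2) = e * (q * x)"
    by (simp add: Suc_Suc_choose_2 power_add e_def x_def)
  have t1: "(1 - a*b*q) * gauss_term q a b (Suc n)
      = (1 - a) * P * (B * (1 - b*x)) * (e * (q*x)) / (Q * (1 - q*x) * D)"
    unfolding gauss_term_def As Bs Qs Ds es using nz by (simp add: mult.assoc)
  have "(1 - a*q) * gauss_term q (a*q\<^sup>2) b (Suc n)
      = ((1 - a*q) * qpoch (a*q\<^sup>2) q (Suc n)) * (B * (1 - b*x)) * (e * (q*x))
          / (Q * (1 - q*x) * (D * (1 - a*b*q^3*x\<^sup>2)))"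
    unfolding gauss_term_def Bs Qs Ds'' es by (simp add: mult.assoc)
  then have t2: "(1 - a*q) * gauss_term q (a*q\<^sup>2) b (Suc n)
      = P * (1 - a*q*x) * (1 - a*q\<^sup>2*x) * (B * (1 - b*x)) * (e * (q*x))
          / (Q * (1 - q*x) * (D * (1 - a*b*q^3*x\<^sup>2)))"
    by (simp only: As'')
  \<comment> \<open>\<open>W\<close> is the common factor of the two new terms and of the old and
    new boundary terms; \<open>w1\<close> to \<open>w4\<close> extract it and leave
    polynomials.\<close>
  define W where "W = P * B * e * q * x * (1 - b*x) / (Q * D * (1 - q*x) * (1 - a*b*q^3*x\<^sup>2))"
  have w1: "(1 - a) * P * (B * (1 - b*x)) * (e * (q*x)) / (Q * (1 - q*x) * D)
      = W * ((1 - a) * (1 - a*b*q^3*x\<^sup>2))"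
    using nz by (simp add: W_def mult_ac)
  have w2: "P * (1 - a*q*x) * (1 - a*q\<^sup>2*x) * (B * (1 - b*x)) * (e * (q*x))
          / (Q * (1 - q*x) * (D * (1 - a*b*q^3*x\<^sup>2))) = W * ((1 - a*q*x) * (1 - a*q\<^sup>2*x))"
    by (simp add: W_def mult_ac)
  have w3: "a * (q*x) * (1 - b*x) * (P * B * e / (Q * D))
      = W * (a * (1 - q*x) * (1 - a*b*q^3*x\<^sup>2))"
    using nz by (simp add: W_def)
  have w4: "a * (q * (q*x)) * (1 - b*(q*x)) *
       (P * (1 - a*q*x) * (B * (1 - b*x)) * (e * (q*x)) / (Q * (1 - q*x) * (D * (1 - a*b*q^3*x\<^sup>2))))
      = W * (a * q * (q*x) * (1 - b*(q*x)) * (1 - a*q*x))"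
    by (simp add: W_def mult_ac)
  \<comment> \<open>Old boundary term plus new summand equals new boundary term, with
    \<open>W\<close> removed.\<close>
  have key: "a * (1 - q*x) * (1 - a*b*q^3*x\<^sup>2)
      + ((1 - a) * (1 - a*b*q^3*x\<^sup>2) - (1 - a*q*x) * (1 - a*q\<^sup>2*x))
      = a * q * (q*x) * (1 - b*(q*x)) * (1 - a*q*x)"
    by algebra
  have IH: "(\<Sum>n\<le>n. (1 - a*b*q) * gauss_term q a b n - (1 - a*q) * gauss_term q (a*q\<^sup>2) b n)
      = a * (q*x) * (1 - b*x) * (P * B * e / (Q * D))"
    using Suc.IH by (simp add: x_def P_def B_def Q_def D_def e_def)
  have "(\<Sum>n\<le>Suc n. (1 - a*b*q) * gauss_term q a b n - (1 - a*q) * gauss_term q (a*q\<^sup>2) b n)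
      = W * (a * q * (q*x) * (1 - b*(q*x)) * (1 - a*q*x))"
    unfolding sum.atMost_Suc IH t1 t2 w1 w2 w3 key[symmetric] by (simp add: algebra_simps)
  also have "\<dots> = a * q ^ Suc (Suc n) * (1 - b * q ^ Suc n) *
      (qpoch (a*q) q (Suc n) * qpoch b q (Suc n) * q ^ (Suc (Suc n) choose 2)
        / (qpoch q q (Suc n) * qpoch (a*b*q^3) (q\<^sup>2) (Suc n)))"
    unfolding As' Bs Qs Ds' es power_Suc x_def[symmetric] w4 ..
  finally show ?case .
qed

text \<open>The boundary term of the telescoped sum tends to 0, since \<open>H\<close> is dominated
  by a summable majorant and its prefactor contains \<open>q ^ Suc N\<close>.\<close>

lemma suminf_gauss_term_rec:
  assumes a: "norm a \<le> 1" and b: "norm b \<le> 1"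
  shows "(1 - a*b*q) * suminf (gauss_term q a b) = (1 - a*q) * suminf (gauss_term q (a*q\<^sup>2) b)"
proof -
  define H where "H = (\<lambda>N. qpoch (a*q) q N * qpoch b q N * q ^ (Suc N choose 2)
                        / (qpoch q q N * qpoch (a*b*q^3) (q\<^sup>2) N))"
  have q2: "norm (q\<^sup>2) \<le> 1" using norm_q_square by simp
  have aq: "norm (a*q) \<le> 1" using a q by (simp add: norm_mult mult_le_one)
  have aq2: "norm (a*q\<^sup>2) \<le> 1" unfolding norm_mult by (intro mult_le_one a q2) simp
  have "norm (a*b*q^3) = norm (a*b*q*(q\<^sup>2)^1)"
    by (simp add: power2_eq_square power3_eq_cube mult.assoc)
  also have "\<dots> \<le> norm q"
    using norm_mult_power_le[OF q2, of "a*b*q" 1] norm_ab_q_le[OF a b] by simp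
  finally have d: "norm (a*b*q^3) \<le> norm q" .
  have H: "H \<longlonglongrightarrow> 0"
  proof (rule Lim_null_comparison)
    show "\<forall>\<^sub>F N in sequentially. norm (H N) \<le> gauss_majorant (norm q) N"
      unfolding H_def by (intro always_eventually allI norm_gauss_quotient_le aq b d)
    show "gauss_majorant (norm q) \<longlonglongrightarrow> 0"
      by (intro summable_LIMSEQ_zero summable_gauss_majorant) (use q in auto)
  qed
  have qN: "(\<lambda>N. q ^ N) \<longlonglongrightarrow> 0" using q by (rule LIMSEQ_power_zero)
  have "(\<lambda>N. a * q ^ Suc N * (1 - b * q^N) * H N) \<longlonglongrightarrow> a * 0 * (1 - b * 0) * 0"
    by (intro tendsto_mult tendsto_diff tendsto_const LIMSEQ_Suc[OF qN] qN H)
  then have "(\<lambda>N. \<Sum>n\<le>N. (1 - a*b*q) * gauss_term q a b n - (1 - a*q) * gauss_term q (a*q\<^sup>2) b n)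
      \<longlonglongrightarrow> 0"
    by (simp add: gauss_term_telescope[OF a b] H_def)
  moreover have "(\<lambda>n. (1 - a*b*q) * gauss_term q a b n - (1 - a*q) * gauss_term q (a*q\<^sup>2) b n) sums
      ((1 - a*b*q) * suminf (gauss_term q a b) - (1 - a*q) * suminf (gauss_term q (a*q\<^sup>2) b))"
    by (intro sums_diff sums_mult summable_sums summable_gauss_term a b aq2)
  ultimately show ?thesis
    unfolding sums_def_le using LIMSEQ_unique by fastforce
qed

lemma suminf_gauss_term_iterate:
  assumes "norm a \<le> 1" "norm b \<le> 1"
  shows "qpoch (a*b*q) (q\<^sup>2) m * suminf (gauss_term q a b)
           = qpoch (a*q) (q\<^sup>2) m * suminf (gauss_term q (a * (q\<^sup>2)^m) b)"
proof (induction m)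
  case (Suc m)
  define a' where "a' = a * (q\<^sup>2)^m"
  have "norm a' \<le> 1"
    using norm_mult_power_le[of "q\<^sup>2" a m] norm_q_square assms(1) unfolding a'_def by simp
  note rec = suminf_gauss_term_rec[OF this assms(2)]
  have "qpoch (a*b*q) (q\<^sup>2) (Suc m) * suminf (gauss_term q a b)
      = (1 - a'*b*q) * (qpoch (a*b*q) (q\<^sup>2) m * suminf (gauss_term q a b))"
    by (simp add: qpoch_Suc a'_def mult_ac)
  also have "\<dots> = qpoch (a*q) (q\<^sup>2) m * ((1 - a'*b*q) * suminf (gauss_term q a' b))"
    unfolding Suc.IH by (simp add: a'_def)
  also have "\<dots> = qpoch (a*q) (q\<^sup>2) (Suc m) * suminf (gauss_term q (a * (q\<^sup>2)^Suc m) b)"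
    unfolding rec by (simp add: qpoch_Suc a'_def mult_ac)
  finally show ?case .
qed simp

text \<open>Let \<open>m\<close> tend to infinity in the iterated recurrence. Since
  \<open>a * (q\<^sup>2)^m\<close> tends to 0 inside the unit disc, the majorant justifies
  exchanging limit and sum by Tannery's theorem.\<close>

lemma suminf_gauss_term_limit:
  assumes a: "norm a \<le> 1" and b: "norm b \<le> 1"
  shows "qpoch_inf (a*b*q) (q\<^sup>2) * suminf (gauss_term q a b)
           = qpoch_inf (a*q) (q\<^sup>2) * suminf (gauss_term q 0 b)"
proof (rule LIMSEQ_unique)
  note q2 = norm_q_square
  define c where "c = (\<lambda>m. a * (q\<^sup>2)^m)"
  have c_le: "norm (c m) \<le> 1" for m
    using norm_mult_power_le[of "q\<^sup>2" a m] q2 a unfolding c_def by simp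
  have "c \<longlonglongrightarrow> a * 0"
    unfolding c_def by (intro tendsto_mult tendsto_const LIMSEQ_power_zero q2)
  then have c: "c \<longlonglongrightarrow> 0" by simp
  have pc: "(\<lambda>m. qpoch (c m * d) p n) \<longlonglongrightarrow> qpoch (0 * d) p n" for d p n
    unfolding qpoch_def by (intro tendsto_intros c)
  \<comment> \<open>The running parameter enters both the numerator (\<open>d = 1\<close>) and the
    denominator (\<open>d = b*q\<close>). The latter factorial tends to 1, so the quotient
    converges.\<close>
  have lim: "(\<lambda>m. gauss_term q (c m) b n) \<longlonglongrightarrow> gauss_term q 0 b n" for n
    unfolding gauss_term_def
    using pc[of 1 q n] pc[of "b*q" "q\<^sup>2" n] qpoch_nonzero[of q q n] q
    by (intro tendsto_intros) (auto simp: mult.assoc qpoch_def)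
  have "(\<lambda>m. suminf (gauss_term q (c m) b)) \<longlonglongrightarrow> suminf (gauss_term q 0 b)"
  proof (intro conjunct2[OF conjunct2[OF
      tannerys_theorem[where a = "\<lambda>n m. gauss_term q (c m) b n" and M = "gauss_majorant (norm q)"]]])
    show "\<forall>\<^sub>F (n, m) in at_top \<times>\<^sub>F sequentially.
            norm (gauss_term q (c m) b n) \<le> gauss_majorant (norm q) n"
      by (auto intro!: always_eventually norm_gauss_term_le c_le b)
    show "summable (gauss_majorant (norm q))"
      using q by (intro summable_gauss_majorant) auto
  qed (use lim in auto)
  then show "(\<lambda>m. qpoch (a*b*q) (q\<^sup>2) m * suminf (gauss_term q a b))
      \<longlonglongrightarrow> qpoch_inf (a*q) (q\<^sup>2) * suminf (gauss_term q 0 b)"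
    unfolding suminf_gauss_term_iterate[OF a b] c_def by (intro tendsto_mult qpoch_tendsto q2)
  show "(\<lambda>m. qpoch (a*b*q) (q\<^sup>2) m * suminf (gauss_term q a b))
      \<longlonglongrightarrow> qpoch_inf (a*b*q) (q\<^sup>2) * suminf (gauss_term q a b)"
    by (intro tendsto_mult tendsto_const qpoch_tendsto q2)
qed

lemma suminf_gauss_term_1: "suminf (gauss_term q 1 b) = 1"
proof -
  have "gauss_term q 1 b n = (if n = 0 then 1 else 0)" for n
    by (cases n) (auto simp: gauss_term_def numeral_2_eq_2)
  then have "gauss_term q 1 b = (\<lambda>n. if n = 0 then 1 else 0)" ..
  then have "gauss_term q 1 b sums 1"
    using sums_single[of 0 "\<lambda>_. 1 :: complex"] by simp
  then show ?thesis by (rule sums_unique[symmetric])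
qed

theorem q_gauss_second:
  assumes a: "norm a \<le> 1" and b: "norm b \<le> 1"
  shows "gauss_term q a b sums
           (qpoch_inf (a*q) (q\<^sup>2) * qpoch_inf (b*q) (q\<^sup>2) / (qpoch_inf (a*b*q) (q\<^sup>2) * qpoch_inf q (q\<^sup>2)))"
proof -
  have "qpoch_inf q (q\<^sup>2) \<noteq> 0" "qpoch_inf (a*b*q) (q\<^sup>2) \<noteq> 0"
    by (intro qpoch_inf_nonzero norm_q_square q le_less_trans[OF norm_ab_q_le[OF a b]])+
  \<comment> \<open>The limit relation at \<open>a = 1\<close>, where the sum on its left is 1,
    determines the sum at \<open>a = 0\<close>.\<close>
  moreover have "qpoch_inf (b*q) (q\<^sup>2) = qpoch_inf q (q\<^sup>2) * suminf (gauss_term q 0 b)"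
    using suminf_gauss_term_limit[of 1 b] b by (simp add: suminf_gauss_term_1)
  ultimately have "suminf (gauss_term q a b) =
      qpoch_inf (a*q) (q\<^sup>2) * qpoch_inf (b*q) (q\<^sup>2) / (qpoch_inf (a*b*q) (q\<^sup>2) * qpoch_inf q (q\<^sup>2))"
    using suminf_gauss_term_limit[OF a b] by (simp add: field_simps)
  then show ?thesis using summable_sums[OF summable_gauss_term[OF a b]] by simp
qed

end

theorem theorem2p3:
  fixes q :: complex
  assumes "norm q < 1"
  shows "(\<lambda>k. qpoch q q k / qpoch q (q\<^sup>2) (k + 1) * q ^ ((k + 1) choose 2))
           sums ((qpoch_inf (q\<^sup>2) (q\<^sup>2))\<^sup>2 / (qpoch_inf q (q\<^sup>2))\<^sup>2)"
proof -
  \<comment> \<open>For \<open>b = q\<close> one numerator factorial cancels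
    \<open>qpoch q q k\<close>. The remaining denominator starts at \<open>q^3\<close>; the factor
    \<open>1 - q\<close> extends it to \<open>qpoch q (q\<^sup>2) (k + 1)\<close>.\<close>
  have eq: "gauss_term q q q k / (1 - q)
      = qpoch q q k / qpoch q (q\<^sup>2) (k + 1) * q ^ ((k + 1) choose 2)" for k
    using qpoch_nonzero[of q q k] assms
    by (simp add: gauss_term_def qpoch_Suc_left power2_eq_square mult_ac)
  have "gauss_term q q q sums (qpoch_inf (q*q) (q\<^sup>2) * qpoch_inf (q*q) (q\<^sup>2)
      / (qpoch_inf (q*q*q) (q\<^sup>2) * qpoch_inf q (q\<^sup>2)))"
    using assms by (intro q_gauss_second) auto
  from sums_divide[OF this, of "1 - q"]
  have "(\<lambda>k. qpoch q q k / qpoch q (q\<^sup>2) (k + 1) * q ^ ((k + 1) choose 2)) sums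
      (qpoch_inf (q*q) (q\<^sup>2) * qpoch_inf (q*q) (q\<^sup>2)
        / (((1 - q) * qpoch_inf (q*q*q) (q\<^sup>2)) * qpoch_inf q (q\<^sup>2)))"
    by (simp add: eq mult_ac)
  \<comment> \<open>The same \<open>1 - q\<close> completes the infinite product starting at
    \<open>q^3\<close>, which produces the square in the denominator.\<close>
  moreover have "qpoch_inf q (q\<^sup>2) = (1 - q) * qpoch_inf (q*q*q) (q\<^sup>2)"
    using qpoch_inf_rec[OF norm_q_square[OF assms], of q] by (simp add: power2_eq_square mult.assoc)
  ultimately show ?thesis by (simp add: power2_eq_square)
qed

end
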